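(* Consider two-user multiple access channels $W(z|x,y)$ with finite input alphabets $\mathcal{X},\mathcal{Y}$ and finite output alphabet $\mathcal{Z}$. Every overwritable MAC is spoofable, and every spoofable MAC is symmetrizable. Furthermore, both inclusions are strict: there exists a spoofable MAC that is not overwritable, and there exists a symmetrizable MAC that is not spoofable.
   Context: **Overwritable.** $W$ is $\mathsf{B}$-overwritable if there is a conditional distribution $P_{X'|X,Y}$ (from $\mathcal{X}\times\mathcal{Y}$ to $\mathcal{X}$) such that $\sum_{x'\in\mathcal{X}}P_{X'|X,Y}(x'|x,y)W(z|x',y')=W(z|x,y)$ for all $x\in\mathcal{X}$, $y,y'\in\mathcal{Y}$, $z\in\mathcal{Z}$. $W$ is $\mathsf{A}$-overwritable if there is a conditional distribution $P_{Y'|X,Y}$ (from $\mathcal{X}\times\mathcal{Y}$ to $\mathcal{Y}$) such that $\sum_{y'\in\mathcal{Y}}P_{Y'|X,Y}(y'|x,y)W(z|x',y')=W(z|x,y)$ for all $x,x'\in\mathcal{X}$, $y\in\mathcal{Y}$, $z\in\mathcal{Z}$. $W$ is overwritable if it is $\mathsf{A}$- or $\mathsf{B}$-overwritable. **Spoofable.** $W$ is $\mathsf{A}$-spoofable if there exist conditional distributions $Q_{Y|\tilde X,\tilde Y}$ (from $\mathcal{X}\times\mathcal{Y}$ to $\mathcal{Y}$) and $Q_{X|\tilde X,X'}$ (from $\mathcal{X}\times\mathcal{X}$ to $\mathcal{X}$) such that for all $x',\tilde x\in\mathcal{X}$, $\tilde y\in\mathcal{Y}$, $z\in\mathcal{Z}$,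 $$\sum_{y}Q_{Y|\tilde X,\tilde Y}(y|\tilde x,\tilde y)W(z|x',y)=\sum_{y}Q_{Y|\tilde X,\tilde Y}(y|x',\tilde y)W(z|\tilde x,y)=\sum_{x}Q_{X|\tilde X,X'}(x|\tilde x,x')W(z|x,\tilde y).$$ $W$ is $\mathsf{B}$-spoofable if there exist conditional distributions $Q_{X|\tilde X,\tilde Y}$ (from $\mathcal{X}\times\mathcal{Y}$ to $\mathcal{X}$) and $Q_{Y|\tilde Y,Y'}$ (from $\mathcal{Y}\times\mathcal{Y}$ to $\mathcal{Y}$) such that for all $\tilde x\in\mathcal{X}$, $\tilde y,y'\in\mathcal{Y}$, $z\in\mathcal{Z}$, $$\sum_{x}Q_{X|\tilde X,\tilde Y}(x|\tilde x,\tilde y)W(z|x,y')=\sum_{x}Q_{X|\tilde X,\tilde Y}(x|\tilde x,y')W(z|x,\tilde y)=\sum_{y}Q_{Y|\tilde Y,Y'}(y|\tilde y,y')W(z|\tilde x,y).$$ $W$ is spoofable if it is $\mathsf{A}$- or $\mathsf{B}$-spoofable. **Symmetrizable.** $W$ is $\mathsf{B}$-symmetrizable if there is a conditional distribution $P_{X|Y}$ (from $\mathcal{Y}$ to $\mathcal{X}$) such that $\sum_{x\in\mathcal{X}}P_{X|Y}(x|y')W(z|x,y)=\sum_{x\in\mathcal{X}}P_{X|Y}(x|y)W(z|x,y')$ for all $y,y'\in\mathcal{Y}$, $z\in\mathcal{Z}$. $W$ is $\mathsf{A}$-symmetrizable if there is a conditional distribution $P_{Y|X}$ (from $\mathcal{X}$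 to $\mathcal{Y}$) such that $\sum_{y\in\mathcal{Y}}P_{Y|X}(y|x')W(z|x,y)=\sum_{y\in\mathcal{Y}}P_{Y|X}(y|x)W(z|x',y)$ for all $x,x'\in\mathcal{X}$, $z\in\mathcal{Z}$. $W$ is symmetrizable if it is $\mathsf{A}$- or $\mathsf{B}$-symmetrizable. *)

theory Defs
  imports "HOL-Probability.Probability_Mass_Function"
begin

text \<open>
  Alphabets are carrier sets, so that one can quantify over them inside a formula.
  Values of a kernel or channel at arguments outside its domain are irrelevant.
  Joint conditioning is rendered by a pair argument: \<open>W(z|x,y)\<close> is \<open>pmf (W (x, y)) z\<close>.
\<close>

definition cond_dist :: "'a set \<Rightarrow> 'b set \<Rightarrow> ('a \<Rightarrow> 'b pmf) \<Rightarrow> bool" where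
  "cond_dist A B K \<longleftrightarrow> (\<forall>a\<in>A. set_pmf (K a) \<subseteq> B)"

definition mac :: "'x set \<Rightarrow> 'y set \<Rightarrow> 'z set \<Rightarrow> ('x \<times> 'y \<Rightarrow> 'z pmf) \<Rightarrow> bool" where
  "mac X Y Z W \<longleftrightarrow>
     finite X \<and> X \<noteq> {} \<and> finite Y \<and> Y \<noteq> {} \<and> finite Z \<and> Z \<noteq> {} \<and> cond_dist (X \<times> Y) Z W"

definition B_overwritable :: "'x set \<Rightarrow> 'y set \<Rightarrow> 'z set \<Rightarrow> ('x \<times> 'y \<Rightarrow> 'z pmf) \<Rightarrow> bool" where
  "B_overwritable X Y Z W \<longleftrightarrow>
     (\<exists>P. cond_dist (X \<times> Y) X P \<and>
       (\<forall>x\<in>X. \<forall>y\<in>Y. \<forall>y'\<in>Y. \<forall>z\<in>Z.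
         (\<Sum>x'\<in>X. pmf (P (x, y)) x' * pmf (W (x', y')) z) = pmf (W (x, y)) z))"

definition A_overwritable :: "'x set \<Rightarrow> 'y set \<Rightarrow> 'z set \<Rightarrow> ('x \<times> 'y \<Rightarrow> 'z pmf) \<Rightarrow> bool" where
  "A_overwritable X Y Z W \<longleftrightarrow>
     (\<exists>P. cond_dist (X \<times> Y) Y P \<and>
       (\<forall>x\<in>X. \<forall>x'\<in>X. \<forall>y\<in>Y. \<forall>z\<in>Z.
         (\<Sum>y'\<in>Y. pmf (P (x, y)) y' * pmf (W (x', y')) z) = pmf (W (x, y)) z))"

definition overwritable :: "'x set \<Rightarrow> 'y set \<Rightarrow> 'z set \<Rightarrow> ('x \<times> 'y \<Rightarrow> 'z pmf) \<Rightarrow> bool" where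
  "overwritable X Y Z W \<longleftrightarrow> A_overwritable X Y Z W \<or> B_overwritable X Y Z W"

text \<open>In the next two definitions \<open>xt\<close> and \<open>yt\<close> stand for x-tilde and y-tilde.\<close>

definition A_spoofable :: "'x set \<Rightarrow> 'y set \<Rightarrow> 'z set \<Rightarrow> ('x \<times> 'y \<Rightarrow> 'z pmf) \<Rightarrow> bool" where
  "A_spoofable X Y Z W \<longleftrightarrow>
     (\<exists>QY QX. cond_dist (X \<times> Y) Y QY \<and> cond_dist (X \<times> X) X QX \<and>
       (\<forall>x'\<in>X. \<forall>xt\<in>X. \<forall>yt\<in>Y. \<forall>z\<in>Z.
         (\<Sum>y\<in>Y. pmf (QY (xt, yt)) y * pmf (W (x', y)) z) =
           (\<Sum>y\<in>Y. pmf (QY (x', yt)) y * pmf (W (xt, y)) z) \<and>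
         (\<Sum>y\<in>Y. pmf (QY (x', yt)) y * pmf (W (xt, y)) z) =
           (\<Sum>x\<in>X. pmf (QX (xt, x')) x * pmf (W (x, yt)) z)))"

definition B_spoofable :: "'x set \<Rightarrow> 'y set \<Rightarrow> 'z set \<Rightarrow> ('x \<times> 'y \<Rightarrow> 'z pmf) \<Rightarrow> bool" where
  "B_spoofable X Y Z W \<longleftrightarrow>
     (\<exists>QX QY. cond_dist (X \<times> Y) X QX \<and> cond_dist (Y \<times> Y) Y QY \<and>
       (\<forall>xt\<in>X. \<forall>yt\<in>Y. \<forall>y'\<in>Y. \<forall>z\<in>Z.
         (\<Sum>x\<in>X. pmf (QX (xt, yt)) x * pmf (W (x, y')) z) =
           (\<Sum>x\<in>X. pmf (QX (xt, y')) x * pmf (W (x, yt)) z) \<and>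
         (\<Sum>x\<in>X. pmf (QX (xt, y')) x * pmf (W (x, yt)) z) =
           (\<Sum>y\<in>Y. pmf (QY (yt, y')) y * pmf (W (xt, y)) z)))"

definition spoofable :: "'x set \<Rightarrow> 'y set \<Rightarrow> 'z set \<Rightarrow> ('x \<times> 'y \<Rightarrow> 'z pmf) \<Rightarrow> bool" where
  "spoofable X Y Z W \<longleftrightarrow> A_spoofable X Y Z W \<or> B_spoofable X Y Z W"

definition B_symmetrizable :: "'x set \<Rightarrow> 'y set \<Rightarrow> 'z set \<Rightarrow> ('x \<times> 'y \<Rightarrow> 'z pmf) \<Rightarrow> bool" where
  "B_symmetrizable X Y Z W \<longleftrightarrow>
     (\<exists>P. cond_dist Y X P \<and>
       (\<forall>y\<in>Y. \<forall>y'\<in>Y. \<forall>z\<in>Z.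
         (\<Sum>x\<in>X. pmf (P y') x * pmf (W (x, y)) z) =
           (\<Sum>x\<in>X. pmf (P y) x * pmf (W (x, y')) z)))"

definition A_symmetrizable :: "'x set \<Rightarrow> 'y set \<Rightarrow> 'z set \<Rightarrow> ('x \<times> 'y \<Rightarrow> 'z pmf) \<Rightarrow> bool" where
  "A_symmetrizable X Y Z W \<longleftrightarrow>
     (\<exists>P. cond_dist X Y P \<and>
       (\<forall>x\<in>X. \<forall>x'\<in>X. \<forall>z\<in>Z.
         (\<Sum>y\<in>Y. pmf (P x') y * pmf (W (x, y)) z) =
           (\<Sum>y\<in>Y. pmf (P x) y * pmf (W (x', y)) z)))"

definition symmetrizable :: "'x set \<Rightarrow> 'y set \<Rightarrow> 'z set \<Rightarrow> ('x \<times> 'y \<Rightarrow> 'z pmf) \<Rightarrow> bool" where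
  "symmetrizable X Y Z W \<longleftrightarrow> A_symmetrizable X Y Z W \<or> B_symmetrizable X Y Z W"

end

theory Submission
  imports Defs
begin

text \<open>
  Freezing the honest argument of an overwriting kernel at one input turns it into a spoofing
  kernel, with a constant second kernel; freezing one argument of a spoofing kernel gives a
  symmetrizing kernel.
  Modulo-2 addition of bits is spoofable because a uniform input of either user makes the output
  uniform, but not overwritable, as no input distribution of one user forces a given output against
  both inputs of the other.
  Integer addition of bits is symmetrized by the identity kernel. If a kernel spoofed it, the input
  drawn given \<open>(0, 1)\<close> could never be \<open>0\<close> (the third expression then excludes output \<open>0\<close>) and
  never be \<open>1\<close> (the symmetry between \<open>0\<close> and \<open>1\<close> excludes output \<open>2\<close>).
\<close>

text \<open>With \<open>P (x0, yt)\<close> as first kernel, the first two spoofing sums both equal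
  \<open>W(z|x0, yt)\<close>, whatever the other input is; the point mass at \<open>x0\<close> gives
  the third sum the same value.\<close>

lemma A_overwritable_imp_A_spoofable:
  assumes "X \<noteq> {}" "finite X" "A_overwritable X Y Z W"
  shows "A_spoofable X Y Z W"
proof -
  obtain x0 where x0: "x0 \<in> X" using assms(1) by blast
  obtain P where P: "cond_dist (X \<times> Y) Y P"
    "\<And>x x' y z. x \<in> X \<Longrightarrow> x' \<in> X \<Longrightarrow> y \<in> Y \<Longrightarrow> z \<in> Z \<Longrightarrow>
       (\<Sum>y'\<in>Y. pmf (P (x, y)) y' * pmf (W (x', y')) z) = pmf (W (x, y)) z"
    using assms(3) unfolding A_overwritable_def by blast
  show ?thesis
    unfolding A_spoofable_def using P x0 assms(2)
    by (intro exI[of _ "\<lambda>(x, y). P (x0, y)"] exI[of _ "\<lambda>_. return_pmf x0"])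
      (auto simp: cond_dist_def pmf_return Collect_conv_if Collect_conv_if2)
qed

text \<open>Here \<open>y0\<close> is frozen, and the common value of the three sums is
  \<open>W(z|xt, y0)\<close>.\<close>

lemma B_overwritable_imp_B_spoofable:
  assumes "Y \<noteq> {}" "finite Y" "B_overwritable X Y Z W"
  shows "B_spoofable X Y Z W"
proof -
  obtain y0 where y0: "y0 \<in> Y" using assms(1) by blast
  obtain P where P: "cond_dist (X \<times> Y) X P"
    "\<And>x y y' z. x \<in> X \<Longrightarrow> y \<in> Y \<Longrightarrow> y' \<in> Y \<Longrightarrow> z \<in> Z \<Longrightarrow>
       (\<Sum>x'\<in>X. pmf (P (x, y)) x' * pmf (W (x', y')) z) = pmf (W (x, y)) z"
    using assms(3) unfolding B_overwritable_def by blast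
  show ?thesis
    unfolding B_spoofable_def using P y0 assms(2)
    by (intro exI[of _ "\<lambda>(x, y). P (x, y0)"] exI[of _ "\<lambda>_. return_pmf y0"])
      (auto simp: cond_dist_def pmf_return Collect_conv_if Collect_conv_if2)
qed

text \<open>At \<open>yt = y0\<close> the first spoofing equality is, up to renaming, the symmetry
  required of \<open>QY (_, y0)\<close>.\<close>

lemma A_spoofable_imp_A_symmetrizable:
  assumes "Y \<noteq> {}" "A_spoofable X Y Z W"
  shows "A_symmetrizable X Y Z W"
proof -
  obtain y0 where y0: "y0 \<in> Y" using assms(1) by blast
  obtain QY where QY: "cond_dist (X \<times> Y) Y QY"
    "\<And>x' xt yt z. x' \<in> X \<Longrightarrow> xt \<in> X \<Longrightarrow> yt \<in> Y \<Longrightarrow> z \<in> Z \<Longrightarrow>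
       (\<Sum>y\<in>Y. pmf (QY (xt, yt)) y * pmf (W (x', y)) z) =
       (\<Sum>y\<in>Y. pmf (QY (x', yt)) y * pmf (W (xt, y)) z)"
    using assms(2) unfolding A_spoofable_def by blast
  have "cond_dist X Y (\<lambda>x. QY (x, y0))"
    using QY(1) y0 by (auto simp: cond_dist_def)
  then show ?thesis
    unfolding A_symmetrizable_def using QY(2) y0 by (intro exI[of _ "\<lambda>x. QY (x, y0)"]) blast
qed

lemma B_spoofable_imp_B_symmetrizable:
  assumes "X \<noteq> {}" "B_spoofable X Y Z W"
  shows "B_symmetrizable X Y Z W"
proof -
  obtain x0 where x0: "x0 \<in> X" using assms(1) by blast
  obtain QX where QX: "cond_dist (X \<times> Y) X QX"
    "\<And>xt yt y' z. xt \<in> X \<Longrightarrow> yt \<in> Y \<Longrightarrow> y' \<in> Y \<Longrightarrow> z \<in> Z \<Longrightarrow>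
       (\<Sum>x\<in>X. pmf (QX (xt, yt)) x * pmf (W (x, y')) z) =
       (\<Sum>x\<in>X. pmf (QX (xt, y')) x * pmf (W (x, yt)) z)"
    using assms(2) unfolding B_spoofable_def by blast
  have "cond_dist Y X (\<lambda>y. QX (x0, y))"
    using QX(1) x0 by (auto simp: cond_dist_def)
  then show ?thesis
    unfolding B_symmetrizable_def using QX(2) x0 by (intro exI[of _ "\<lambda>y. QX (x0, y)"]) blast
qed

definition xor_mac :: "nat \<times> nat \<Rightarrow> nat pmf" where
  "xor_mac = (\<lambda>(x, y). return_pmf ((x + y) mod 2))"

lemma pmf_xor_mac: "pmf (xor_mac (x, y)) z = (if z = (x + y) mod 2 then 1 else 0)"
  by (simp add: xor_mac_def pmf_return)

lemma mac_xor: "mac {0, 1} {0, 1} {0, 1} xor_mac"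
  by (auto simp: mac_def cond_dist_def xor_mac_def)

lemma A_spoofable_xor: "A_spoofable {0, 1} {0, 1} {0, 1} xor_mac"
  unfolding A_spoofable_def
  \<comment> \<open>The uniform kernel serves as both \<open>QY\<close> and \<open>QX\<close>; all
    three sums are then 1/2.\<close>
  by (intro exI[of _ "\<lambda>_. pmf_of_set {0, 1}"]) (auto simp: cond_dist_def pmf_xor_mac)

lemma not_overwritable_xor: "\<not> overwritable {0, 1} {0, 1} {0, 1} xor_mac"
proof -
  \<comment> \<open>For \<open>x = y = 0\<close>, the mass of \<open>P (0, 0)\<close> at 0 must be 1
    (take \<open>x' = 0\<close>, \<open>z = 0\<close>) and also 0 (take \<open>x' = 1\<close>,
    \<open>z = 1\<close>).\<close>
  have "\<not> A_overwritable {0, 1} {0, 1} {0, 1} xor_mac"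
    unfolding A_overwritable_def by (auto simp: pmf_xor_mac)
  moreover have "\<not> B_overwritable {0, 1} {0, 1} {0, 1} xor_mac"
    unfolding B_overwritable_def by (auto simp: pmf_xor_mac)
  ultimately show ?thesis by (simp add: overwritable_def)
qed

definition adder_mac :: "nat \<times> nat \<Rightarrow> nat pmf" where
  "adder_mac = (\<lambda>(x, y). return_pmf (x + y))"

lemma pmf_adder_mac: "pmf (adder_mac (x, y)) z = (if z = x + y then 1 else 0)"
  by (simp add: adder_mac_def pmf_return)

lemma mac_adder: "mac {0, 1} {0, 1} {0, 1, 2} adder_mac"
  by (auto simp: mac_def cond_dist_def adder_mac_def)

lemma A_symmetrizable_adder: "A_symmetrizable {0, 1} {0, 1} {0, 1, 2} adder_mac"
  unfolding A_symmetrizable_def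
  \<comment> \<open>Both sides become the indicator of \<open>z = x + x'\<close>, by commutativity
    of addition.\<close>
  by (intro exI[of _ return_pmf]) (auto simp: cond_dist_def pmf_adder_mac pmf_return
      Collect_conv_if Collect_conv_if2)

lemma pmf_bit_sum:
  assumes "set_pmf p \<subseteq> {0, 1 :: nat}"
  shows "pmf p 0 + pmf p 1 = 1"
  using sum_pmf_eq_1[of "{0, 1}" p] assms by simp

lemma not_A_spoofable_adder: "\<not> A_spoofable {0, 1} {0, 1} {0, 1, 2} adder_mac"
proof
  assume "A_spoofable {0, 1} {0, 1} {0, 1, 2} adder_mac"
  then obtain QY QX where QY: "cond_dist ({0, 1} \<times> {0, 1}) {0, 1} QY"
    and eq: "\<forall>x'\<in>{0, 1}. \<forall>xt\<in>{0, 1}. \<forall>yt\<in>{0, 1}. \<forall>z\<in>{0, 1, 2}.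
         (\<Sum>y\<in>{0, 1}. pmf (QY (xt, yt)) y * pmf (adder_mac (x', y)) z) =
           (\<Sum>y\<in>{0, 1}. pmf (QY (x', yt)) y * pmf (adder_mac (xt, y)) z) \<and>
         (\<Sum>y\<in>{0, 1}. pmf (QY (x', yt)) y * pmf (adder_mac (xt, y)) z) =
           (\<Sum>x\<in>{0, 1}. pmf (QX (xt, x')) x * pmf (adder_mac (x, yt)) z)"
    unfolding A_spoofable_def by blast
  \<comment> \<open>First \<open>x' = xt = 0\<close>, \<open>z = 0\<close>: no \<open>x + 1\<close>
    is 0. Then \<open>x' = 1\<close>, \<open>xt = 0\<close>, \<open>z = 2\<close>: no
    \<open>0 + y\<close> is 2 for a bit \<open>y\<close>.\<close>
  have "pmf (QY (0, 1)) 0 = 0" "pmf (QY (0, 1)) 1 = 0"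
    using eq by (auto simp: pmf_adder_mac)
  moreover have "pmf (QY (0, 1)) 0 + pmf (QY (0, 1)) 1 = 1"
    using QY by (intro pmf_bit_sum) (auto simp: cond_dist_def)
  ultimately show False by simp
qed

lemma not_B_spoofable_adder: "\<not> B_spoofable {0, 1} {0, 1} {0, 1, 2} adder_mac"
proof
  assume "B_spoofable {0, 1} {0, 1} {0, 1, 2} adder_mac"
  then obtain QX QY where QX: "cond_dist ({0, 1} \<times> {0, 1}) {0, 1} QX"
    and eq: "\<forall>xt\<in>{0, 1}. \<forall>yt\<in>{0, 1}. \<forall>y'\<in>{0, 1}. \<forall>z\<in>{0, 1, 2}.
         (\<Sum>x\<in>{0, 1}. pmf (QX (xt, yt)) x * pmf (adder_mac (x, y')) z) =
           (\<Sum>x\<in>{0, 1}. pmf (QX (xt, y')) x * pmf (adder_mac (x, yt)) z) \<and>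
         (\<Sum>x\<in>{0, 1}. pmf (QX (xt, y')) x * pmf (adder_mac (x, yt)) z) =
           (\<Sum>y\<in>{0, 1}. pmf (QY (yt, y')) y * pmf (adder_mac (xt, y)) z)"
    unfolding B_spoofable_def by blast
  \<comment> \<open>With the users exchanged the critical pair is \<open>(1, 0)\<close>: take
    \<open>y' = 0\<close>, \<open>z = 0\<close> in the third sum, then \<open>y' = 1\<close>,
    \<open>z = 2\<close> in the symmetry.\<close>
  have "pmf (QX (1, 0)) 0 = 0" "pmf (QX (1, 0)) 1 = 0"
    using eq by (auto simp: pmf_adder_mac)
  moreover have "pmf (QX (1, 0)) 0 + pmf (QX (1, 0)) 1 = 1"
    using QX by (intro pmf_bit_sum) (auto simp: cond_dist_def)
  ultimately show False by simp
qed

theorem proposition5: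
  shows "(\<forall>(X :: 'x set) (Y :: 'y set) (Z :: 'z set) W.
            mac X Y Z W \<and> overwritable X Y Z W \<longrightarrow> spoofable X Y Z W) \<and>
         (\<forall>(X :: 'x set) (Y :: 'y set) (Z :: 'z set) W.
            mac X Y Z W \<and> spoofable X Y Z W \<longrightarrow> symmetrizable X Y Z W) \<and>
         (\<exists>(X :: nat set) (Y :: nat set) (Z :: nat set) W.
            mac X Y Z W \<and> spoofable X Y Z W \<and> \<not> overwritable X Y Z W) \<and>
         (\<exists>(X :: nat set) (Y :: nat set) (Z :: nat set) W.
            mac X Y Z W \<and> symmetrizable X Y Z W \<and> \<not> spoofable X Y Z W)"
proof (intro conjI allI impI)
  fix X :: "'x set" and Y :: "'y set" and Z :: "'z set" and W
  assume "mac X Y Z W \<and> overwritable X Y Z W"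
  then show "spoofable X Y Z W"
    unfolding mac_def overwritable_def spoofable_def
    by (metis A_overwritable_imp_A_spoofable B_overwritable_imp_B_spoofable)
next
  fix X :: "'x set" and Y :: "'y set" and Z :: "'z set" and W
  assume "mac X Y Z W \<and> spoofable X Y Z W"
  then show "symmetrizable X Y Z W"
    unfolding mac_def spoofable_def symmetrizable_def
    by (metis A_spoofable_imp_A_symmetrizable B_spoofable_imp_B_symmetrizable)
next
  show "\<exists>(X :: nat set) (Y :: nat set) (Z :: nat set) W.
      mac X Y Z W \<and> spoofable X Y Z W \<and> \<not> overwritable X Y Z W"
    using mac_xor A_spoofable_xor not_overwritable_xor unfolding spoofable_def by blast
next
  show "\<exists>(X :: nat set) (Y :: nat set) (Z :: nat set) W.
      mac X Y Z W \<and> symmetrizable X Y Z W \<and> \<not> spoofable X Y Z W"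
    using mac_adder A_symmetrizable_adder not_A_spoofable_adder not_B_spoofable_adder
    unfolding symmetrizable_def spoofable_def by blast
qed

end
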